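(* Let $n\ge 32$ and let $m$ be such that $n\in\Gamma_{2,m,1}$. Then $m\ge 6$. Put $$\theta_m^4=\tfrac{-t_m+4t_{m-1}+t_{m-2}-1}{2},\quad \theta_m^5=\tfrac{3t_m-5t_{m-2}-1}{2},\quad \eta_m^2=2t_{m-1}-t_{m-2},$$ $$\theta_m^6=\tfrac{3t_m-2t_{m-1}-t_{m-2}-1}{2},\quad \theta_m^7=\tfrac{t_m+2t_{m-1}-t_{m-2}-1}{2}.$$ Then $\sum_{i=\min\Gamma_{2,m,1}}^{n}a(i)$ is equal to: (i) $\sum_{i=\min\Gamma_{3,m-2,1}}^{n-t_{m-1}}a(i)$ if $\theta_m^4\le n<\theta_m^5$; (ii) $\sum_{i=\min\Gamma_{2,m-2,1}}^{n-t_{m-1}}a(i)+\sum a(\Gamma_{3,m-2,1})$ if $\theta_m^5\le n<\eta_m^2$; (iii) $\sum_{i=\min\Gamma_{2,m-2,1}}^{n-t_{m-1}}a(i)+\sum a(\Gamma_{3,m-2,1})+n-\eta_m^2+1$ if $\eta_m^2\le n<\theta_m^6$; (iv) $\sum_{i=\min\Gamma_{1,m-2,1}}^{n-t_{m-1}}a(i)+\sum a(\Gamma_{3,m-2,1})+\sum a(\Gamma_{2,m-2,1})+n-\eta_m^2+1$ otherwise (that is, if $\theta_m^6\le n<\theta_m^7$).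
   Context: The Tribonacci sequence $\mathbb{T}$ is the fixed point beginning with $a$ of the substitution $\sigma(a)=ab,\ \sigma(b)=ac,\ \sigma(c)=a$; positions are numbered from $1$. For a nonempty factor $\omega$ of $\mathbb{T}$, $\omega_p$ denotes its $p$-th occurrence. The word $\omega_p\omega_{p+1}$ is a (repeated) square if $\omega_{p+1}$ begins immediately after $\omega_p$ ends. For $n\ge 1$, $a(n)$ is the number of pairs $(\omega,p)$ such that $\omega_p\omega_{p+1}$ is a square ending exactly at position $n$. The Tribonacci numbers are $t_m=|\sigma^m(a)|$ for $m\ge 0$ ($t_0=1,t_1=2,t_2=4,t_3=7$, $t_m=t_{m-1}+t_{m-2}+t_{m-3}$). For $m\ge 4$ define the sets of consecutive integers $$\Gamma_{1,m,1}=\left\{\tfrac{t_m+2t_{m-1}-t_{m-2}-1}{2},\dots,\tfrac{t_m+2t_{m-1}+t_{m-2}-3}{2}\right\},$$ $$\Gamma_{2,m,1}=\left\{\tfrac{-t_m+4t_{m-1}+t_{m-2}-1}{2},\dots,\tfrac{t_m+2t_{m-1}-t_{m-2}-3}{2}\right\},$$ $$\Gamma_{3,m,1}=\left\{\tfrac{t_m+t_{m-2}-1}{2},\dots,\tfrac{-t_m+4t_{m-1}+t_{m-2}-3}{2}\right\}.$$ Write $\sum a(\Gamma)=\sum_{i\in\Gamma}a(i)$. *)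

theory Defs
  imports Complex_Main
begin

section \<open>The Tribonacci word\<close>

datatype letter = La | Lb | Lc

fun sigma_letter :: "letter \<Rightarrow> letter list" where
  "sigma_letter La = [La, Lb]"
| "sigma_letter Lb = [La, Lc]"
| "sigma_letter Lc = [La]"

definition sigma :: "letter list \<Rightarrow> letter list" where
  "sigma w = concat (map sigma_letter w)"

text \<open>
  Infinite words are functions on \<open>nat\<close> whose positions are numbered from 1;
  the value at 0 is irrelevant.
\<close>

definition word_prefix :: "(nat \<Rightarrow> letter) \<Rightarrow> nat \<Rightarrow> letter list" where
  "word_prefix u N = map u [1..<Suc N]"

definition sigma_fixed_point :: "(nat \<Rightarrow> letter) \<Rightarrow> bool" where
  "sigma_fixed_point u \<longleftrightarrow>
     (\<forall>N. sigma (word_prefix u N) = word_prefix u (length (sigma (word_prefix u N))))"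

text \<open>
  \<open>sigma\<close> iterated \<open>i\<close> times on the letter \<open>a\<close> has length greater than \<open>i\<close> and is a prefix of
  all later iterates, so the following is their limit. The lemmas \<open>trib_fixed_point\<close> and
  \<open>trib_unique\<close> show that it is the one fixed point of \<open>sigma\<close> beginning with \<open>a\<close>.
\<close>

definition trib :: "nat \<Rightarrow> letter" where
  "trib i = (sigma ^^ i) [La] ! (i - 1)"

definition t :: "nat \<Rightarrow> int" where
  "t m = int (length ((sigma ^^ m) [La]))"


section \<open>Occurrences and repeated squares\<close>

definition occurs_at :: "letter list \<Rightarrow> nat \<Rightarrow> bool" where
  "occurs_at w i \<longleftrightarrow> 1 \<le> i \<and> (\<forall>k<length w. trib (i + k) = w ! k)"

text \<open>\<open>nth_occurrence w p i\<close>: the \<open>p\<close>-th occurrence of \<open>w\<close>, counted from 1, begins at \<open>i\<close>.\<close>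

definition nth_occurrence :: "letter list \<Rightarrow> nat \<Rightarrow> nat \<Rightarrow> bool" where
  "nth_occurrence w p i \<longleftrightarrow> occurs_at w i \<and> card {j. j \<le> i \<and> occurs_at w j} = p"

text \<open>
  The pairs counted by \<open>a n\<close>. Since \<open>w\<close> occurs at \<open>i\<close>, it is a factor and \<open>p \<ge> 1\<close>.
  Positions are taken in \<open>int\<close> so that differences of positions are not truncated.
\<close>

definition squares_ending_at :: "int \<Rightarrow> (letter list \<times> nat) set" where
  "squares_ending_at n = {(w, p). w \<noteq> [] \<and>
     (\<exists>i. nth_occurrence w p i \<and> nth_occurrence w (p + 1) (i + length w) \<and>
          int (i + 2 * length w) - 1 = n)}"

definition a :: "int \<Rightarrow> nat" where
  "a n = card (squares_ending_at n)"


section \<open>The sets of consecutive integers and the thresholds\<close>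

text \<open>
  All divisions by 2 below are exact, because \<open>t m\<close> and \<open>t (m - 2)\<close> have opposite
  parities for \<open>m \<ge> 2\<close> (lemma \<open>t_parity\<close>). The sets are used for \<open>m \<ge> 4\<close> only.
\<close>

definition Gamma1 :: "nat \<Rightarrow> int set" where
  "Gamma1 m = {(t m + 2 * t (m - 1) - t (m - 2) - 1) div 2 ..
               (t m + 2 * t (m - 1) + t (m - 2) - 3) div 2}"

definition Gamma2 :: "nat \<Rightarrow> int set" where
  "Gamma2 m = {(- t m + 4 * t (m - 1) + t (m - 2) - 1) div 2 ..
               (t m + 2 * t (m - 1) - t (m - 2) - 3) div 2}"

definition Gamma3 :: "nat \<Rightarrow> int set" where
  "Gamma3 m = {(t m + t (m - 2) - 1) div 2 ..
               (- t m + 4 * t (m - 1) + t (m - 2) - 3) div 2}"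

definition theta4 :: "nat \<Rightarrow> int" where
  "theta4 m = (- t m + 4 * t (m - 1) + t (m - 2) - 1) div 2"

definition theta5 :: "nat \<Rightarrow> int" where
  "theta5 m = (3 * t m - 5 * t (m - 2) - 1) div 2"

definition theta6 :: "nat \<Rightarrow> int" where
  "theta6 m = (3 * t m - 2 * t (m - 1) - t (m - 2) - 1) div 2"

definition theta7 :: "nat \<Rightarrow> int" where
  "theta7 m = (t m + 2 * t (m - 1) - t (m - 2) - 1) div 2"

definition eta2 :: "nat \<Rightarrow> int" where
  "eta2 m = 2 * t (m - 1) - t (m - 2)"


section \<open>Sanity checks on the definitions\<close>

lemma sigma_append: "sigma (u @ v) = sigma u @ sigma v"
  by (simp add: sigma_def)

lemma sigma_pow_append: "(sigma ^^ n) (u @ v) = (sigma ^^ n) u @ (sigma ^^ n) v"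
  by (induction n) (simp_all add: sigma_append)

lemma sigma_pow_La: "(sigma ^^ Suc n) [La] = (sigma ^^ n) [La] @ (sigma ^^ n) [Lb]"
proof -
  have "(sigma ^^ Suc n) [La] = (sigma ^^ n) (sigma [La])"
    by (simp add: funpow_swap1)
  also have "sigma [La] = [La] @ [Lb]" by (simp add: sigma_def)
  finally show ?thesis by (simp only: sigma_pow_append)
qed

lemma sigma_pow_Lb: "(sigma ^^ Suc n) [Lb] = (sigma ^^ n) [La] @ (sigma ^^ n) [Lc]"
proof -
  have "(sigma ^^ Suc n) [Lb] = (sigma ^^ n) (sigma [Lb])"
    by (simp add: funpow_swap1)
  also have "sigma [Lb] = [La] @ [Lc]" by (simp add: sigma_def)
  finally show ?thesis by (simp only: sigma_pow_append)
qed

lemma sigma_pow_Lc: "(sigma ^^ Suc n) [Lc] = (sigma ^^ n) [La]"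
proof -
  have "(sigma ^^ Suc n) [Lc] = (sigma ^^ n) (sigma [Lc])"
    by (simp add: funpow_swap1)
  also have "sigma [Lc] = [La]" by (simp add: sigma_def)
  finally show ?thesis .
qed

lemma t_initial: "t 0 = 1" "t 1 = 2" "t 2 = 4" "t 3 = 7"
  by (simp_all add: t_def sigma_def numeral_eq_Suc)

lemma t_rec: "t (m + 3) = t (m + 2) + t (m + 1) + t m"
proof -
  have m3: "m + 3 = Suc (Suc (Suc m))" and m2: "m + 2 = Suc (Suc m)" by simp_all
  show ?thesis
    unfolding t_def m3 m2
    using sigma_pow_La[of "Suc (Suc m)"] sigma_pow_Lb[of "Suc m"] sigma_pow_Lc[of m]
    by (metis add.assoc length_append of_nat_add Suc_eq_plus1)
qed

lemma t_parity: "m \<ge> 2 \<Longrightarrow> odd (t m + t (m - 2))"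
proof -
  have "odd (t (k + 2) + t k) \<and> odd (t (k + 3) + t (k + 1))" for k
  proof (induction k)
    case 0
    show ?case using t_initial by (simp add: numeral_eq_Suc)
  next
    case (Suc k)
    have "t (k + 4) = t (k + 3) + t (k + 2) + t (k + 1)"
      using t_rec[of "k + 1"] by (simp add: numeral_eq_Suc)
    moreover have "t (k + 3) = t (k + 2) + t (k + 1) + t k"
      by (rule t_rec)
    ultimately show ?case using Suc by (simp add: numeral_eq_Suc)
  qed
  then show "m \<ge> 2 \<Longrightarrow> odd (t m + t (m - 2))"
    by (metis le_add_diff_inverse2)
qed

lemma sigma_eq_Nil: "sigma w = [] \<longleftrightarrow> w = []"
proof (cases w)
  case (Cons x xs)
  then show ?thesis by (cases x) (simp_all add: sigma_def)
qed (simp add: sigma_def)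

lemma sigma_pow_eq_Nil: "(sigma ^^ n) w = [] \<longleftrightarrow> w = []"
  by (induction n) (simp_all add: sigma_eq_Nil)

lemma length_sigma_pow: "n < length ((sigma ^^ n) [La])"
proof (induction n)
  case (Suc n)
  have "length ((sigma ^^ n) [Lb]) > 0" by (simp add: sigma_pow_eq_Nil)
  with Suc show ?case unfolding sigma_pow_La length_append by linarith
qed simp

lemma sigma_pow_prefix: "m \<le> n \<Longrightarrow> \<exists>v. (sigma ^^ n) [La] = (sigma ^^ m) [La] @ v"
proof (induction n rule: dec_induct)
  case (step n)
  then show ?case unfolding sigma_pow_La by auto
qed simp

lemma trib_eq_nth:
  assumes "1 \<le> i" "i \<le> length ((sigma ^^ n) [La])"
  shows "trib i = (sigma ^^ n) [La] ! (i - 1)"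
proof (cases "i \<le> n")
  case True
  then obtain v where "(sigma ^^ n) [La] = (sigma ^^ i) [La] @ v"
    using sigma_pow_prefix by blast
  then show ?thesis
    using length_sigma_pow[of i] less_imp_diff_less[OF length_sigma_pow[of i], of 1]
    by (simp add: trib_def nth_append)
next
  case False
  then obtain v where "(sigma ^^ i) [La] = (sigma ^^ n) [La] @ v"
    using sigma_pow_prefix[of n i] by auto
  moreover have "i - 1 < length ((sigma ^^ n) [La])" using assms by linarith
  ultimately show ?thesis by (simp add: trib_def nth_append)
qed

lemma word_prefix_trib:
  "N \<le> length ((sigma ^^ n) [La]) \<Longrightarrow> word_prefix trib N = take N ((sigma ^^ n) [La])"
  unfolding word_prefix_def
  by (rule nth_equalityI) (auto simp: trib_eq_nth[of _ n] simp del: upt_Suc)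

lemma trib_fixed_point: "sigma_fixed_point trib"
  unfolding sigma_fixed_point_def
proof
  fix N
  let ?P = "(sigma ^^ N) [La]"
  have "word_prefix trib N = take N ?P"
    using word_prefix_trib[of N N] length_sigma_pow[of N] by simp
  moreover have "(sigma ^^ Suc N) [La] = sigma (take N ?P) @ sigma (drop N ?P)"
    by (simp flip: sigma_append)
  ultimately show
    "sigma (word_prefix trib N) = word_prefix trib (length (sigma (word_prefix trib N)))"
    using word_prefix_trib[of "length (sigma (take N ?P))" "Suc N"] by simp
qed

lemma trib_1: "trib 1 = La"
  by (simp add: trib_def sigma_def)

lemma trib_unique:
  assumes "sigma_fixed_point u" "u 1 = La" "i \<ge> 1"
  shows "u i = trib i"
proof -
  have "word_prefix u (length ((sigma ^^ n) [La])) = (sigma ^^ n) [La]" for n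
  proof (induction n)
    case 0
    then show ?case using assms(2) by (simp add: word_prefix_def)
  next
    case (Suc n)
    then show ?case
      using assms(1) unfolding sigma_fixed_point_def
      by (metis comp_apply funpow.simps(2))
  qed
  then have "word_prefix u (length ((sigma ^^ i) [La])) ! (i - 1) = (sigma ^^ i) [La] ! (i - 1)"
    by simp
  then show ?thesis
    using assms(3) length_sigma_pow[of i]
    by (simp add: word_prefix_def trib_def del: upt_Suc)
qed

lemma finite_squares_ending_at: "finite (squares_ending_at n)"
proof (rule finite_subset)
  have UN: "(UNIV :: letter set) = {La, Lb, Lc}"
    using letter.exhaust by blast
  have "finite {w :: letter list. set w \<subseteq> UNIV \<and> length w \<le> nat n}"
    by (rule finite_lists_length_le) (simp add: UN)
  then show "finite ({w :: letter list. length w \<le> nat n} \<times> {..nat n})" by simp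
  show "squares_ending_at n \<subseteq> {w. length w \<le> nat n} \<times> {..nat n}"
  proof
    fix x assume "x \<in> squares_ending_at n"
    then obtain w p i where x: "x = (w, p)" "w \<noteq> []" "nth_occurrence w p i"
      "int (i + 2 * length w) - 1 = n"
      by (auto simp: squares_ending_at_def)
    have "{j. j \<le> i \<and> occurs_at w j} \<subseteq> {1..i}" by (auto simp: occurs_at_def)
    then have "p \<le> card {1..i}"
      using x(3) card_mono[of "{1..i}"] unfolding nth_occurrence_def by auto
    moreover have "length w > 0" using x(2) by simp
    moreover have "i \<ge> 1"
      using x(3) by (simp add: nth_occurrence_def occurs_at_def)
    ultimately have "p \<le> nat n" "length w \<le> nat n"
      using x(4) by (simp_all only: card_atLeastAtMost)
    with x show "x \<in> {w. length w \<le> nat n} \<times> {..nat n}" by simp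
  qed
qed

end

theory Submission
  imports Defs
begin

text \<open>
  Extend two equal stretches \<open>T[X..X+L)\<close>, \<open>T[Y..Y+L)\<close> of the word as far as possible in both
  directions. If \<open>L > 0\<close>, both begin with the letter \<open>a\<close>, hence at a block boundary of \<open>\<sigma>\<close>, and they
  come from a shorter maximal pair: distinct letters have images with distinct last letters, while
  their images followed by \<open>a\<close> agree in exactly one letter. Iterating, every maximal pair is
  the \<open>\<sigma>\<^sup>k\<close>-image of an empty one, and its length is \<open>D\<^sub>k = t\<^sub>0 + \<dots> + t\<^bsub>k-1\<^esub>\<close>.

  A square of period \<open>p\<close> needs \<open>p \<le> D\<^sub>k\<close>. As \<open>D\<^sub>k\<close> is smaller than the length of \<open>\<sigma>\<^sup>k\<close> of any two
  consecutive letters, \<open>p\<close> is the length of the \<open>\<sigma>\<^sup>k\<close>-image of a single letter at some position \<open>x\<close>,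
  and the square lies between \<open>|\<sigma>\<^sup>k(T[0..x))|\<close> and \<open>|\<sigma>\<^sup>k(T[0..x])| + D\<^sub>k\<close>.

  For \<open>e\<close> in \<open>\<Gamma>\<^bsub>2,m,1\<^esub>\<close>, that is \<open>D\<^bsub>m-3\<^esub> < e - t\<^bsub>m-1\<^esub> \<le> D\<^bsub>m-2\<^esub>\<close>, the squares ending at \<open>e\<close> and starting
  after \<open>t\<^bsub>m-1\<^esub>\<close> are the translates of those ending at \<open>e - t\<^bsub>m-1\<^esub>\<close>. By the localisation above, the only
  further one has \<open>k = m - 2\<close>, \<open>x = 1\<close>, and it is present iff \<open>e \<ge> \<eta>\<^sub>m\<^sup>2\<close>. So
  \<open>a(e) = a(e - t\<^bsub>m-1\<^esub>) + [e \<ge> \<eta>\<^sub>m\<^sup>2]\<close>, which is summed.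
\<close>

section \<open>Desubstitution of repeated stretches\<close>

text \<open>Positions are 0-based from here on.\<close>

definition trib0 :: "nat \<Rightarrow> letter" where
  "trib0 i = trib (Suc i)"

text \<open>As the word is fixed by \<open>sigma\<close>, this is also the position at which the
  image of its letter at \<open>n\<close> begins.\<close>

definition phi :: "nat \<Rightarrow> nat" where
  "phi n = length (sigma (word_prefix trib n))"

text \<open>By \<open>Phi_0\<close> and \<open>Phi_Suc\<close>, \<open>Phi k n\<close> is the length
  of the \<open>k\<close>-fold image of the first \<open>n\<close> letters.\<close>

abbreviation Phi :: "nat \<Rightarrow> nat \<Rightarrow> nat" where
  "Phi k \<equiv> phi ^^ k"

definition tlen :: "nat \<Rightarrow> nat" where
  "tlen k = length ((sigma ^^ k) [La])"

text \<open>The \<open>D\<^sub>k\<close> of the introduction.\<close>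

definition pal_len :: "nat \<Rightarrow> nat" where
  "pal_len k = (\<Sum>j<k. tlen j)"

definition match :: "nat \<Rightarrow> nat \<Rightarrow> nat \<Rightarrow> bool" where
  "match X Y L \<longleftrightarrow> (\<forall>j<L. trib0 (X + j) = trib0 (Y + j))"

section \<open>Blocks of the substitution inside the word\<close>

lemma word_prefix_Suc: "word_prefix trib (Suc n) = word_prefix trib n @ [trib0 n]"
  by (simp add: word_prefix_def trib0_def)

lemma length_word_prefix [simp]: "length (word_prefix u n) = n"
  by (simp add: word_prefix_def del: upt_Suc)

lemma nth_word_prefix: "i < n \<Longrightarrow> word_prefix trib n ! i = trib0 i"
  by (simp add: word_prefix_def trib0_def del: upt_Suc)

lemma phi_0 [simp]: "phi 0 = 0"
  by (simp add: phi_def word_prefix_def sigma_def)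

lemma phi_Suc: "phi (Suc n) = phi n + length (sigma_letter (trib0 n))"
  by (simp add: phi_def word_prefix_Suc sigma_append) (simp add: sigma_def)

lemma trib0_phi_add:
  assumes "j < length (sigma_letter (trib0 n))"
  shows "trib0 (phi n + j) = sigma_letter (trib0 n) ! j"
proof -
  have fixp: "sigma (word_prefix trib N) = word_prefix trib (phi N)" for N
    using trib_fixed_point by (simp add: sigma_fixed_point_def phi_def)
  have "word_prefix trib (phi (Suc n)) = word_prefix trib (phi n) @ sigma_letter (trib0 n)"
    unfolding fixp[symmetric] by (simp add: word_prefix_Suc sigma_append) (simp add: sigma_def)
  moreover have "phi n + j < phi (Suc n)" using assms by (simp add: phi_Suc)
  ultimately show ?thesis using nth_word_prefix[of "phi n + j" "phi (Suc n)"]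
    by (simp add: nth_append)
qed

lemma trib0_phi [simp]: "trib0 (phi n) = La"
  using trib0_phi_add[of 0 n] by (cases "trib0 n") auto

text \<open>After the one-letter block of \<open>Lc\<close> the next block supplies
  \<open>La\<close>, so in all three cases this letter identifies the block.\<close>

lemma trib0_Suc_phi:
  "trib0 (Suc (phi n)) = (case trib0 n of La \<Rightarrow> Lb | Lb \<Rightarrow> Lc | Lc \<Rightarrow> La)"
proof (cases "trib0 n")
  case Lc
  then show ?thesis using trib0_phi[of "Suc n"] by (simp add: phi_Suc)
qed (use trib0_phi_add[of 1 n] in auto)

lemma trib0_Suc_phi_eq_iff: "trib0 (Suc (phi x)) = trib0 (Suc (phi y)) \<longleftrightarrow> trib0 x = trib0 y"
  by (auto simp: trib0_Suc_phi split: letter.splits)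

lemma trib0_pred_phi_Suc:
  "trib0 (phi (Suc n) - 1) = (case trib0 n of La \<Rightarrow> Lb | Lb \<Rightarrow> Lc | Lc \<Rightarrow> La)"
  using trib0_Suc_phi[of n] by (cases "trib0 n") (simp_all add: phi_Suc)

lemma strict_mono_phi: "strict_mono phi"
proof -
  have "phi n < phi (Suc n)" for n by (cases "trib0 n") (simp_all add: phi_Suc)
  then show ?thesis by (simp add: strict_mono_Suc_iff)
qed

lemma phi_add_ge: "phi u + v \<le> phi (u + v)"
  by (induction v) (use strict_mono_phi in \<open>auto simp: strict_mono_Suc_iff
      intro: le_less_trans[THEN Suc_leI]\<close>)

lemma phi_block: "\<exists>x. phi x \<le> N \<and> N < phi (Suc x)"
proof (induction N)
  case 0
  show ?case using strict_mono_phi by (intro exI[of _ 0]) (metis le0 lessI phi_0 strict_mono_less)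
next
  case (Suc N)
  then obtain x where x: "phi x \<le> N" "N < phi (Suc x)" by blast
  show ?case
  proof (cases "Suc N < phi (Suc x)")
    case True
    then show ?thesis using x by (intro exI[of _ x]) simp
  next
    case False
    then have "Suc N = phi (Suc x)" using x by simp
    then show ?thesis using strict_mono_phi
      by (intro exI[of _ "Suc x"]) (metis lessI order_refl strict_mono_less)
  qed
qed

lemma trib0_La_cases:
  obtains x where "N = phi x" | x where "trib0 N \<noteq> La" "N = Suc (phi x)" "Suc N = phi (Suc x)"
proof -
  obtain x where x: "phi x \<le> N" "N < phi (Suc x)" using phi_block by blast
  show thesis
  proof (cases "N = phi x")
    case False
    then have "N = Suc (phi x)" "trib0 x \<noteq> Lc" "phi (Suc x) = phi x + 2"
      using x by (cases "trib0 x"; simp add: phi_Suc)+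
    then show thesis
      using that(2)[of x] trib0_Suc_phi[of x] by (cases "trib0 x") auto
  qed (use that in blast)
qed

lemma trib0_La_iff: "trib0 N = La \<longleftrightarrow> N \<in> range phi"
  by (metis rangeE rangeI trib0_La_cases trib0_phi)

lemma trib0_Suc_not_La: "trib0 N \<noteq> La \<Longrightarrow> trib0 (Suc N) = La"
  by (metis trib0_La_cases trib0_phi)

lemma trib0_pred_not_La: "trib0 N \<noteq> La \<Longrightarrow> N > 0 \<and> trib0 (N - 1) = La"
  by (metis diff_Suc_1 trib0_La_cases trib0_phi zero_less_Suc)

lemma match_phi_diff: "match x y l \<Longrightarrow> phi (x + l) + phi y = phi (y + l) + phi x"
  by (induction l) (auto simp: match_def phi_Suc)

text \<open>Equal letters have equal images; the \<open>+ 1\<close> is the \<open>La\<close> that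
  opens the next block on both sides.\<close>

lemma match_phi:
  assumes "match x y l"
  shows "match (phi x) (phi y) (phi (x + l) + 1 - phi x)"
  using assms
proof (induction l)
  case 0
  then show ?case by (simp add: match_def)
next
  case (Suc l)
  have le: "phi x \<le> phi (x + l)" "phi y \<le> phi (y + l)"
    using strict_mono_phi by (simp_all add: strict_mono_less_eq)
  have eq: "trib0 (x + l) = trib0 (y + l)" using Suc.prems by (simp add: match_def)
  have IH: "match (phi x) (phi y) (phi (x + l) + 1 - phi x)"
    using Suc by (simp add: match_def)
  have d: "phi (x + l) + phi y = phi (y + l) + phi x"
    using Suc.prems by (intro match_phi_diff) (simp add: match_def)
  show ?case unfolding match_def
  proof (intro allI impI)
    fix j assume j: "j < phi (x + Suc l) + 1 - phi x"
    show "trib0 (phi x + j) = trib0 (phi y + j)"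
    proof (cases "j < phi (x + l) + 1 - phi x")
      case True
      then show ?thesis using IH by (simp add: match_def)
    next
      case False
      then obtain i where i: "j = phi (x + l) - phi x + i" "i \<le> length (sigma_letter (trib0 (x + l)))"
        using j le by (auto simp: phi_Suc intro!: that[of "j - (phi (x + l) - phi x)"])
      then have X: "phi x + j = phi (x + l) + i" "phi y + j = phi (y + l) + i"
        using le d by simp_all
      show ?thesis
      proof (cases "i < length (sigma_letter (trib0 (x + l)))")
        case True
        then show ?thesis unfolding X using eq by (simp add: trib0_phi_add)
      next
        case False
        then have "phi (x + l) + i = phi (Suc (x + l))" "phi (y + l) + i = phi (Suc (y + l))"
          using i eq by (simp_all add: phi_Suc)
        then show ?thesis unfolding X by simp
      qed
    qed
  qed
qed

text \<open>Makes every match stop on the right. An eventual period desubstitutes to one that is no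
  larger; equality would force one-letter blocks only, but \<open>Lc\<close> is followed by
  \<open>La\<close>.\<close>

lemma trib0_aperiodic: "p > 0 \<Longrightarrow> \<exists>j. trib0 (s + j) \<noteq> trib0 (s + p + j)"
proof (induction p arbitrary: s rule: less_induct)
  case (less p)
  show ?case
  proof (rule ccontr)
    assume "\<not> ?thesis"
    then have per0: "trib0 (s + j) = trib0 (s + p + j)" for j by blast
    have "\<exists>d. trib0 (s + d) = La"
      using trib0_Suc_not_La[of s] by (metis add.right_neutral add_Suc_right)
    then obtain d where d: "trib0 (s + d) = La" by blast
    then obtain x where x: "s + d = phi x" using trib0_La_iff by blast
    have "trib0 (s + d + p) = La" using per0[of d] d by (simp add: ac_simps)
    then obtain y where y: "s + d + p = phi y" using trib0_La_iff by blast
    have per: "trib0 (phi x + j) = trib0 (phi y + j)" for j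
      using per0[of "d + j"] unfolding x[symmetric] y[symmetric] by (simp add: ac_simps)
    have "phi x < phi y" using x y less.prems by simp
    then have xy: "x < y" using strict_mono_phi strict_mono_less by blast
    have m: "match x y l" for l
    proof (induction l)
      case (Suc l)
      have le: "phi x \<le> phi (x + l)" "phi y \<le> phi (y + l)"
        using strict_mono_phi by (simp_all add: strict_mono_less_eq)
      have "phi (x + l) + phi y = phi (y + l) + phi x" by (rule match_phi_diff[OF Suc])
      then have "phi x + Suc (phi (x + l) - phi x) = Suc (phi (x + l))"
        "phi y + Suc (phi (x + l) - phi x) = Suc (phi (y + l))"
        using le by linarith+
      then have "trib0 (Suc (phi (x + l))) = trib0 (Suc (phi (y + l)))"
        using per[of "Suc (phi (x + l) - phi x)"] by simp
      then have "trib0 (x + l) = trib0 (y + l)" by (simp add: trib0_Suc_phi_eq_iff)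
      with Suc show ?case by (auto simp: match_def less_Suc_eq)
    qed (simp add: match_def)
    have all: "trib0 (x + j) = trib0 (x + (y - x) + j)" for j
      using m[of "Suc j"] xy by (simp add: match_def)
    have "y - x = p"
      using less.IH[of "y - x" x] all xy phi_add_ge[of x "y - x"] x y by fastforce
    then have "phi y = phi x + (y - x)" using x y by simp
    moreover have "phi (Suc x) + (y - Suc x) \<le> phi y" using phi_add_ge[of "Suc x" "y - Suc x"] xy by simp
    ultimately have "phi (Suc x) \<le> phi x + 1" using xy by simp
    then have c: "trib0 x = Lc" by (cases "trib0 x") (simp_all add: phi_Suc)
    then have a: "trib0 (Suc x) = La" by (simp add: trib0_Suc_not_La)
    then have "y \<noteq> Suc x" using all[of 0] c by auto
    then have "Suc (Suc x) \<le> y" using xy by simp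
    then have "phi (Suc (Suc x)) + (y - Suc (Suc x)) \<le> phi y"
      using phi_add_ge[of "Suc (Suc x)" "y - Suc (Suc x)"] by (simp only: le_add_diff_inverse)
    then show False
      using \<open>phi y = phi x + (y - x)\<close> \<open>Suc (Suc x) \<le> y\<close> a c by (simp add: phi_Suc)
  qed
qed

section \<open>Maximal matches and their desubstitution\<close>

definition max_match :: "nat \<Rightarrow> nat \<Rightarrow> nat \<Rightarrow> bool" where
  "max_match X Y L \<longleftrightarrow> X < Y \<and> match X Y L \<and> trib0 (X + L) \<noteq> trib0 (Y + L) \<and>
     (X = 0 \<or> trib0 (X - 1) \<noteq> trib0 (Y - 1))"

lemma match_extend:
  assumes "match s (s + p) L" "p > 0"
  obtains X M where "max_match X (X + p) M" "X \<le> s" "s + L \<le> X + M"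
proof -
  \<comment> \<open>\<open>P X\<close> says that the match reaches left to \<open>X\<close>; the
    least such \<open>X\<close> cannot be extended.\<close>
  define P where "P X \<longleftrightarrow> X \<le> s \<and> (\<forall>i. X \<le> i \<and> i < s \<longrightarrow> trib0 i = trib0 (i + p))" for X
  define X where "X = (LEAST X. P X)"
  have "P X"
    unfolding X_def by (rule LeastI[of P s]) (auto simp: P_def)
  then have X: "X \<le> s \<and> (\<forall>i. X \<le> i \<and> i < s \<longrightarrow> trib0 i = trib0 (i + p))"
    by (simp add: P_def)
  define M where "M = (LEAST M. trib0 (X + M) \<noteq> trib0 (X + p + M))"
  have M: "trib0 (X + M) \<noteq> trib0 (X + p + M)"
    unfolding M_def using trib0_aperiodic[OF assms(2)] by (rule LeastI_ex)
  have m: "match X (X + p) M"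
    unfolding match_def by (auto simp: M_def dest: not_less_Least)
  have left: "X = 0 \<or> trib0 (X - 1) \<noteq> trib0 (X + p - 1)"
  proof (rule ccontr)
    assume "\<not> ?thesis"
    then have pos: "X > 0" and eq: "trib0 (X - 1) = trib0 (X - 1 + p)" by auto
    have "trib0 i = trib0 (i + p)" if "X - 1 \<le> i" "i < s" for i
      using that X eq by (cases "i = X - 1") auto
    then have "P (X - 1)" using X by (auto simp: P_def)
    then have "X \<le> X - 1" using Least_le[of P "X - 1"] by (simp flip: X_def)
    with pos show False by simp
  qed
  have "s + L \<le> X + M"
  proof (rule ccontr)
    assume less: "\<not> ?thesis"
    have "trib0 (X + M) = trib0 (X + M + p)"
    proof (cases "X + M < s")
      case False
      then obtain j where "X + M = s + j" "j < L"
        using less by (metis add_less_cancel_left le_Suc_ex not_le)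
      then show ?thesis using assms(1) by (simp add: match_def ac_simps)
    qed (use X in auto)
    with M show False by (simp add: ac_simps)
  qed
  then show thesis using that[of X M] X m M left assms(2) by (auto simp: max_match_def)
qed

lemma max_match_desubstitute:
  assumes "max_match X Y L" "L > 0"
  obtains x y l where "max_match x y l" "X = phi x" "Y = phi y" "X + L = phi (x + l) + 1"
proof -
  have XY: "X < Y" and m: "match X Y L" and ne: "trib0 (X + L) \<noteq> trib0 (Y + L)"
    and left: "X = 0 \<or> trib0 (X - 1) \<noteq> trib0 (Y - 1)"
    using assms by (auto simp: max_match_def)
  have eq0: "trib0 X = trib0 Y" using m assms(2) by (auto simp: match_def dest: spec[of _ 0])
  \<comment> \<open>Otherwise both stretches would be preceded by \<open>La\<close>, against
    maximality on the left.\<close>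
  have "trib0 X = La"
    using left trib0_pred_not_La[of X] trib0_pred_not_La[of Y] eq0 by (metis less_irrefl)
  then obtain x y where xy: "X = phi x" "Y = phi y"
    using eq0 by (metis trib0_La_iff rangeE)
  have "x < y" using XY xy strict_mono_phi strict_mono_less by blast
  define l where "l = (LEAST l. trib0 (x + l) \<noteq> trib0 (x + (y - x) + l))"
  have l: "trib0 (x + l) \<noteq> trib0 (y + l)"
    using LeastI_ex[OF trib0_aperiodic[of "y - x" x]] \<open>x < y\<close> by (simp add: l_def)
  have ml: "match x y l"
    unfolding match_def using not_less_Least[of _ "\<lambda>l. trib0 (x + l) \<noteq> trib0 (x + (y - x) + l)"] \<open>x < y\<close>
    by (auto simp: l_def)
  have le: "phi x \<le> phi (x + l)" "phi y \<le> phi (y + l)"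
    using strict_mono_phi by (simp_all add: strict_mono_less_eq)
  have m': "match X Y (phi (x + l) + 1 - phi x)"
    using match_phi[OF ml] xy by simp
  have ne': "trib0 (X + (phi (x + l) + 1 - phi x)) \<noteq> trib0 (Y + (phi (x + l) + 1 - phi x))"
  proof -
    have "X + (phi (x + l) + 1 - phi x) = Suc (phi (x + l))"
      "Y + (phi (x + l) + 1 - phi x) = Suc (phi (y + l))"
      using le xy match_phi_diff[OF ml] by simp_all
    then show ?thesis using l by (simp add: trib0_Suc_phi_eq_iff)
  qed
  \<comment> \<open>Both numbers are the offset of the first mismatch.\<close>
  have "L = phi (x + l) + 1 - phi x"
    using m m' ne ne' unfolding match_def by (metis linorder_neqE_nat)
  then have "X + L = phi (x + l) + 1" using le xy by simp
  \<comment> \<open>Equal preceding letters would have images with equal last letters, extending the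
    original match to the left.\<close>
  moreover have "x = 0 \<or> trib0 (x - 1) \<noteq> trib0 (y - 1)"
  proof (cases x)
    case (Suc x')
    obtain y' where y': "y = Suc y'" using \<open>x < y\<close> by (cases y) auto
    have "X \<noteq> 0" using strict_mono_phi xy Suc by (metis phi_0 strict_mono_eq nat.distinct(1))
    then show ?thesis
      using left xy Suc y' trib0_pred_phi_Suc[of x'] trib0_pred_phi_Suc[of y'] by auto
  qed simp
  ultimately show thesis
    using that[of x y l] \<open>x < y\<close> ml l xy by (simp add: max_match_def)
qed

section \<open>Iterated images and the lengths of maximal matches\<close>

lemma Phi_Suc: "Phi k (Suc n) = Phi k n + length ((sigma ^^ k) [trib0 n])"
proof (induction k arbitrary: n)
  case (Suc k)
  have "Phi (Suc k) (Suc n) = Phi k (phi (Suc n))" by (simp add: funpow_swap1)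
  also have "\<dots> = Phi k (phi n) + length ((sigma ^^ Suc k) [trib0 n])"
  proof (cases "trib0 n")
    case La
    then show ?thesis using trib0_Suc_phi[of n] sigma_pow_La[of k]
      by (simp add: phi_Suc Suc del: funpow.simps)
  next
    case Lb
    then show ?thesis using trib0_Suc_phi[of n] sigma_pow_Lb[of k]
      by (simp add: phi_Suc Suc del: funpow.simps)
  next
    case Lc
    then show ?thesis using sigma_pow_Lc[of k]
      by (simp add: phi_Suc Suc del: funpow.simps)
  qed
  finally show ?case by (simp add: funpow_swap1)
qed simp

lemma strict_mono_Phi: "strict_mono (Phi k)"
  by (simp add: strict_mono_Suc_iff Phi_Suc sigma_pow_eq_Nil)

lemma Phi_0 [simp]: "Phi k 0 = 0"
  by (induction k) simp_all

lemma trib0_0: "trib0 0 = La"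
  by (simp_all add: trib0_def trib_def sigma_def numeral_eq_Suc)

lemma Phi_1: "Phi k (Suc 0) = tlen k"
  by (simp add: Phi_Suc trib0_0 tlen_def)

text \<open>Each \<open>+ 1\<close> appends one \<open>La\<close>; the remaining steps stretch these
  letters to lengths \<open>tlen (k - 1)\<close> down to \<open>tlen 0\<close>, with sum
  \<open>pal_len k\<close>.\<close>

lemma Phi_phi_Suc_funpow: "((\<lambda>e. phi e + 1) ^^ k) x = Phi k x + pal_len k"
proof (induction k arbitrary: x)
  case (Suc k)
  have "((\<lambda>e. phi e + 1) ^^ Suc k) x = ((\<lambda>e. phi e + 1) ^^ k) (phi x + 1)"
    by (simp only: funpow_Suc_right o_apply)
  also have "\<dots> = Phi k (Suc (phi x)) + pal_len k" using Suc by simp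
  also have "\<dots> = Phi (Suc k) x + pal_len (Suc k)"
    by (simp add: Phi_Suc tlen_def pal_len_def funpow_swap1)
  finally show ?case .
qed (simp add: pal_len_def)

lemma max_match_structure:
  assumes "max_match X Y L"
  shows "\<exists>k x y. X = Phi k x \<and> Y = Phi k y \<and> L = pal_len k \<and> max_match x y 0"
proof -
  \<comment> \<open>The right end point, not the length, transforms uniformly: each step sends it from \<open>e\<close> to
    \<open>phi e + 1\<close>, and the left end point from \<open>e\<close> to \<open>phi e\<close>.\<close>
  have "\<exists>k x y. X = Phi k x \<and> Y = Phi k y \<and> X + L = ((\<lambda>e. phi e + 1) ^^ k) x \<and> max_match x y 0"
    using assms
  proof (induction L arbitrary: X Y rule: less_induct)
    case (less L)
    show ?case
    proof (cases "L = 0")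
      case True
      then show ?thesis using less.prems
        by - (rule exI[of _ "0::nat"], rule exI[of _ X], rule exI[of _ Y], simp)
    next
      case False
      then obtain x y l where xyl: "max_match x y l" "X = phi x" "Y = phi y" "X + L = phi (x + l) + 1"
        using max_match_desubstitute[OF less.prems] by blast
      have "l < L" using xyl phi_add_ge[of x l] by simp
      from less.IH[OF this xyl(1)] obtain k x' y' where
        "x = Phi k x'" "y = Phi k y'" "x + l = ((\<lambda>e. phi e + 1) ^^ k) x'" "max_match x' y' 0" by blast
      then show ?thesis using xyl
        by - (rule exI[of _ "Suc k"], rule exI[of _ x'], rule exI[of _ y'], simp)
    qed
  qed
  then show ?thesis by (metis Phi_phi_Suc_funpow add_left_cancel)
qed

text \<open>The converse source of matches: it supplies the equal stretches used in
  \<open>a_shift\<close>.\<close>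

lemma match_Phi: "match (Phi k x) (Phi k y) (pal_len k)"
proof (induction k)
  case 0
  show ?case by (simp add: pal_len_def match_def)
next
  case (Suc k)
  have "phi (Phi k x + pal_len k) + 1 = Phi (Suc k) x + pal_len (Suc k)"
    using Phi_phi_Suc_funpow[of "Suc k" x] by (simp flip: Phi_phi_Suc_funpow)
  then show ?case using match_phi[OF Suc] by simp
qed

section \<open>The periods of squares\<close>

lemma tlen_initial: "tlen 0 = 1" "tlen (Suc 0) = 2" "tlen 2 = 4" "tlen 3 = 7" "tlen 4 = 13"
  by (simp_all add: tlen_def sigma_def numeral_eq_Suc)

lemma tlen_rec: "tlen (k + 3) = tlen (k + 2) + tlen (k + 1) + tlen k"
  using t_rec[of k] by (simp add: t_def tlen_def)

text \<open>The inequalities are linear, so the recurrence carries them from three consecutive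
  indices to the next.\<close>

lemma tlen_bounds:
  "0 < tlen k \<and> tlen k < tlen (k + 1) \<and> tlen (k + 1) \<le> 2 * tlen k \<and> tlen (k + 1) + tlen k \<le> tlen (k + 2)"
proof (induction k rule: less_induct)
  case (less k)
  have 2: "Suc (Suc 0) = 2" "Suc 2 = 3" by simp_all
  consider "k = 0" | "k = 1" | "k = 2" | j where "k = j + 3"
    by (metis One_nat_def add.commute le_Suc_ex less_2_cases not_less_eq_eq numeral_2_eq_2 numeral_3_eq_3 le_antisym not_less)
  then show ?case
  proof cases
    case 4
    then show ?thesis
      using less.IH[of j] less.IH[of "j + 1"] less.IH[of "j + 2"]
        tlen_rec[of j] tlen_rec[of "j + 1"] tlen_rec[of "j + 2"]
      by (simp add: eval_nat_numeral)
  qed (simp_all add: tlen_initial 2)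
qed

lemma pal_len_less: "pal_len (k + 1) < tlen (k + 1) + tlen k"
proof (induction k)
  case 0
  show ?case using tlen_initial by (simp add: pal_len_def)
next
  case (Suc k)
  then show ?case using tlen_bounds[of k] tlen_rec[of k] tlen_bounds[of "k+1"]
    by (simp add: pal_len_def eval_nat_numeral)
qed

text \<open>Links the range of \<open>d\<close> in \<open>a_shift\<close> to the halved expressions
  bounding the \<open>Gamma\<close> sets.\<close>

lemma pal_len_tlen: "2 * pal_len (k + 1) + 3 = tlen (k + 2) + tlen k"
proof (induction k)
  case 0
  show ?case using tlen_initial by (simp add: pal_len_def flip: numeral_2_eq_2)
next
  case (Suc k)
  then show ?case using tlen_rec[of k] by (simp add: pal_len_def eval_nat_numeral)
qed

text \<open>Every image under \<open>sigma\<close> starts with \<open>La\<close>.\<close>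

lemma length_sigma_pow_ge: "tlen k \<le> length ((sigma ^^ Suc k) [x])"
proof (cases x)
  case La then show ?thesis by (simp add: sigma_pow_La tlen_def del: funpow.simps)
next
  case Lb then show ?thesis by (simp add: sigma_pow_Lb tlen_def del: funpow.simps)
next
  case Lc then show ?thesis by (simp add: sigma_pow_Lc tlen_def del: funpow.simps)
qed

lemma Phi_Suc_ge: "Phi (Suc k) x + tlen k \<le> Phi (Suc k) (Suc x)"
  using length_sigma_pow_ge[of k] by (simp add: Phi_Suc del: funpow.simps)

text \<open>Of two consecutive letters one is \<open>La\<close>, with image length
  \<open>tlen k\<close>; for \<open>k > 0\<close> the other contributes at least
  \<open>tlen (k - 1)\<close>.\<close>

lemma Phi_add_two: "Phi k x + pal_len k < Phi k (x + 2)"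
proof (cases k)
  case 0
  then show ?thesis by (simp add: pal_len_def)
next
  case (Suc j)
  have "length ((sigma ^^ k) [trib0 x]) + length ((sigma ^^ k) [trib0 (Suc x)]) \<ge> tlen k + tlen j"
    using length_sigma_pow_ge[of j "trib0 x"] length_sigma_pow_ge[of j "trib0 (Suc x)"]
      trib0_Suc_not_La[of x] Suc by (cases "trib0 x = La") (auto simp: tlen_def)
  then show ?thesis using pal_len_less[of j] Suc by (simp add: Phi_Suc del: funpow.simps)
qed

lemma repetition_structure:
  assumes "match s (s + p) L" "0 < p" "p \<le> L"
  obtains k x where "Phi k x \<le> s" "Phi k (Suc x) = Phi k x + p" "s + L \<le> Phi k x + pal_len k"
proof -
  obtain X M where X: "max_match X (X + p) M" "X \<le> s" "s + L \<le> X + M"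
    using match_extend[OF assms(1,2)] .
  obtain k x y where k: "X = Phi k x" "X + p = Phi k y" "M = pal_len k" "max_match x y 0"
    using max_match_structure[OF X(1)] by blast
  have "x < y" using k by (simp add: max_match_def)
  \<comment> \<open>Since \<open>p \<le> L \<le> M\<close>, the point \<open>X + p\<close> is at
    most the end of the match starting at \<open>X\<close>.\<close>
  have "Phi k y < Phi k (x + 2)"
    using X k assms(3) Phi_add_two[of k x] by linarith
  then have "y < x + 2" using strict_mono_Phi strict_mono_less by blast
  then have "y = Suc x" using \<open>x < y\<close> by simp
  then show thesis using that[of k x] X k by simp
qed

text \<open>At level \<open>j + 1\<close> the period is at least \<open>tlen j\<close>, while the
  match is no longer than \<open>pal_len (j + 1) < 3 * tlen j\<close>.\<close>

lemma no_fourth_power: "0 < p \<Longrightarrow> 3 * p \<le> L \<Longrightarrow> \<not> match s (s + p) L"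
proof
  assume p: "0 < p" "3 * p \<le> L" and m: "match s (s + p) L"
  have "p \<le> L" using p by simp
  then obtain k x where k: "Phi k x \<le> s" "Phi k (Suc x) = Phi k x + p" "s + L \<le> Phi k x + pal_len k"
    using repetition_structure[OF m p(1)] by blast
  show False
  proof (cases k)
    case 0
    then show False using p k by (simp add: pal_len_def)
  next
    case (Suc j)
    then show False
      using k p Phi_Suc_ge[of j x] pal_len_less[of j] tlen_bounds[of j] by simp
  qed
qed

text \<open>\<open>e\<close> is the number of letters up to the end of the square, hence its last position when
  positions are counted from 1.\<close>

definition square_periods :: "nat \<Rightarrow> nat set" where
  "square_periods e = {p. 0 < p \<and> 2 * p \<le> e \<and> match (e - 2 * p) (e - p) p}"

lemma square_primitive:
  assumes "match s (s + p) p" "0 < d" "d < p"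
  shows "\<not> match s (s + d) p"
proof
  assume md: "match s (s + d) p"
  have P: "trib0 i = trib0 (i + p)" if "s \<le> i" "i < s + p" for i
    using that assms(1) by (auto simp: match_def ac_simps dest: spec[of _ "i - s"])
  have Dd: "trib0 i = trib0 (i + d)" if "s \<le> i" "i < s + p" for i
    using that md by (auto simp: match_def ac_simps dest: spec[of _ "i - s"])
  \<comment> \<open>Both \<open>d\<close> and \<open>p - d\<close> are periods of \<open>T[s..s+2p)\<close>; the smaller one is repeated too often.\<close>
  show False
  proof (cases "2 * d \<le> p")
    case True
    \<comment> \<open>In the second half the equality is obtained by going back \<open>p\<close>,
      forward \<open>d\<close>, and forward \<open>p\<close> again.\<close>
    have "match s (s + d) (2 * p - d)"
      unfolding match_def
    proof (intro allI impI)
      fix j assume j: "j < 2 * p - d"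
      show "trib0 (s + j) = trib0 (s + d + j)"
      proof (cases "j < p")
        case True
        then show ?thesis using Dd[of "s + j"] by (simp add: ac_simps)
      next
        case False
        then show ?thesis
          using j P[of "s + j - p"] Dd[of "s + j - p"] P[of "s + j + d - p"] by (simp add: ac_simps)
      qed
    qed
    then show False using no_fourth_power[of d "2 * p - d" s] True assms by simp
  next
    case False
    \<comment> \<open>A shift by \<open>p - d\<close> goes forward \<open>p\<close> and back
      \<open>d\<close>, in whichever order stays within range.\<close>
    have "match s (s + (p - d)) (p + d)"
      unfolding match_def
    proof (intro allI impI)
      fix j assume j: "j < p + d"
      show "trib0 (s + j) = trib0 (s + (p - d) + j)"
      proof (cases "j < d")
        case True
        then show ?thesis
          using assms(2,3) P[of "s + j"] Dd[of "s + j + p - d"] by (simp add: ac_simps)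
      next
        case False
        then show ?thesis
          using assms(2,3) j P[of "s + j - d"] Dd[of "s + j - d"] by (simp add: ac_simps)
      qed
    qed
    moreover have "3 * (p - d) \<le> p + d" using False by linarith
    ultimately show False using no_fourth_power[of "p - d" "p + d" s] assms by simp
  qed
qed

section \<open>Repeated squares counted by their periods\<close>

lemma occurs_at_iff: "occurs_at w (Suc s) \<longleftrightarrow> (\<forall>k<length w. trib0 (s + k) = w ! k)"
  by (simp add: occurs_at_def trib0_def)

text \<open>By \<open>square_primitive\<close> no occurrence starts strictly between the two halves,
  so every square is a repeated square.\<close>

lemma nth_occurrence_next:
  assumes "nth_occurrence w q (Suc s)" "match s (s + length w) (length w)" "w \<noteq> []"
  shows "nth_occurrence w (q + 1) (Suc s + length w)"
proof -
  let ?p = "length w"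
  have w: "\<forall>k<?p. trib0 (s + k) = w ! k" and q: "card {j. j \<le> Suc s \<and> occurs_at w j} = q"
    using assms(1) by (simp_all add: nth_occurrence_def occurs_at_iff)
  have w': "occurs_at w (Suc (s + ?p))"
    using assms(2) w by (simp add: occurs_at_iff match_def)
  have "{j. j \<le> Suc (s + ?p) \<and> occurs_at w j} = insert (Suc (s + ?p)) {j. j \<le> Suc s \<and> occurs_at w j}"
  proof (intro equalityI subsetI)
    fix j assume j: "j \<in> {j. j \<le> Suc (s + ?p) \<and> occurs_at w j}"
    show "j \<in> insert (Suc (s + ?p)) {j. j \<le> Suc s \<and> occurs_at w j}"
    proof (rule ccontr)
      assume "\<not> ?thesis"
      then have "Suc s < j" "j < Suc (s + ?p)" using j by auto
      then obtain d where d: "j = Suc (s + d)" "0 < d" "d < ?p"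
        by (auto intro!: that[of "j - Suc s"])
      have "match s (s + d) ?p"
        using j w unfolding d(1) by (simp add: occurs_at_iff match_def)
      then show False using square_primitive[OF assms(2) d(2,3)] by simp
    qed
  qed (use w' in auto)
  then have "card {j. j \<le> Suc (s + ?p) \<and> occurs_at w j} = q + 1"
    using q assms(3) by simp
  then show ?thesis using w' by (simp add: nth_occurrence_def)
qed

text \<open>End and period fix the start, hence the word and its occurrence number; conversely
  \<open>nth_occurrence_next\<close> turns each period into a counted pair.\<close>

lemma a_eq_card: "a (int e) = card (square_periods e)"
proof -
  have "bij_betw (\<lambda>(w, q). length w) (squares_ending_at (int e)) (square_periods e)"
    unfolding bij_betw_def
  proof (intro conjI equalityI subsetI)
    show "inj_on (\<lambda>(w, q). length w) (squares_ending_at (int e))"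
    proof (rule inj_onI, clarify)
      fix w q w' q'
      assume wq: "(w, q) \<in> squares_ending_at (int e)" "(w', q') \<in> squares_ending_at (int e)"
        and len: "length w = length w'"
      obtain i where i: "nth_occurrence w q i" "int (i + 2 * length w) - 1 = int e"
        using wq(1) by (auto simp: squares_ending_at_def)
      obtain i' where i': "nth_occurrence w' q' i'" "int (i' + 2 * length w') - 1 = int e"
        using wq(2) by (auto simp: squares_ending_at_def)
      have "i = i'" using i(2) i'(2) len by simp
      moreover have "w = w'"
      proof (rule nth_equalityI[OF len])
        show "w ! j = w' ! j" if "j < length w" for j
          using that i(1) i'(1) len \<open>i = i'\<close> by (metis nth_occurrence_def occurs_at_def)
      qed
      ultimately show "w = w' \<and> q = q'" using i i' by (simp add: nth_occurrence_def)
    qed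
  next
    fix p assume "p \<in> (\<lambda>(w, q). length w) ` squares_ending_at (int e)"
    then obtain w q i where w: "p = length w" "w \<noteq> []" "nth_occurrence w q i"
      "nth_occurrence w (q + 1) (i + length w)" "int (i + 2 * length w) - 1 = int e"
      by (auto simp: squares_ending_at_def)
    then obtain s where s: "i = Suc s"
      by (cases i) (auto simp: nth_occurrence_def occurs_at_def)
    have e: "e = s + 2 * p" using w(1,5) s by simp
    have "match s (s + p) p"
      using w s by (simp add: match_def nth_occurrence_def occurs_at_iff)
    then show "p \<in> square_periods e" using e w(1,2) by (simp add: square_periods_def add.commute)
  next
    fix p assume p: "p \<in> square_periods e"
    define s where "s = e - 2 * p"
    have e: "e = s + 2 * p" and m: "match s (s + p) p" and p0: "0 < p"
      using p by (auto simp: square_periods_def s_def)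
    define w where "w = map (\<lambda>k. trib0 (s + k)) [0..<p]"
    have lw: "length w = p" by (simp add: w_def)
    obtain q where q: "nth_occurrence w q (Suc s)"
      by (simp add: nth_occurrence_def occurs_at_iff w_def)
    have "(w, q) \<in> squares_ending_at (int e)"
      unfolding squares_ending_at_def
      using q nth_occurrence_next[OF q] m lw p0 e by (auto intro!: exI[of _ "Suc s"])
    then show "p \<in> (\<lambda>(w, q). length w) ` squares_ending_at (int e)"
      using lw by force
  qed
  then show ?thesis by (simp add: a_def bij_betw_same_card)
qed

section \<open>The recursion for \<open>a\<close> under translation\<close>

lemma strict_mono_tlen: "strict_mono tlen"
  using tlen_bounds by (simp add: strict_mono_Suc_iff)

text \<open>\<open>p0\<close> is the length of the \<open>(k + 1)\<close>-fold image of the second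
  letter \<open>Lb\<close>, the period of the one square that can be gained.\<close>

lemma a_shift:
  fixes k d :: nat
  defines "p0 \<equiv> tlen (k + 2) - tlen (k + 1)"
  assumes "pal_len k < d" "d \<le> pal_len (k + 1)"
  shows "a (int (tlen (k + 2) + d)) =
    a (int d) + (if tlen (k + 1) + 2 * p0 \<le> tlen (k + 2) + d then 1 else 0)"
proof -
  let ?B = "tlen (k + 2)" and ?e = "tlen (k + 2) + d"
  \<comment> \<open>The word begins with \<open>sigma [La]\<close>, so boundary 1 at level
    \<open>k + 2\<close> is boundary 2 at level \<open>k + 1\<close>.\<close>
  have "phi (Suc 0) = 2" by (simp add: phi_Suc trib0_0)
  moreover have "Phi (Suc (k + 1)) (Suc 0) = Phi (k + 1) (phi (Suc 0))"
    by (simp only: funpow_Suc_right o_apply)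
  ultimately have B: "?B = Phi (k + 1) 2"
    using Phi_1[of "Suc (k + 1)"] by simp
  have p0: "Phi (k + 1) 2 = Phi (k + 1) 1 + p0" "Phi (k + 1) 1 = tlen (k + 1)" "0 < p0"
    using B Phi_1[of "k + 1"] tlen_bounds[of "k + 1"] by (simp_all add: p0_def)
  have pal: "pal_len (k + 1) = pal_len k + tlen k" "pal_len (k + 1) < tlen (k + 2)"
    using pal_len_less[of k] tlen_bounds[of k] by (simp_all add: pal_len_def)
  have inner: "p \<in> square_periods ?e \<and> ?B + 2 * p \<le> ?e \<longleftrightarrow> p \<in> square_periods d" for p
  proof -
    \<comment> \<open>The letters at 0 and 1 have \<open>(k + 2)\<close>-fold images starting at 0
      and \<open>?B\<close>.\<close>
    have eq: "trib0 i = trib0 (?B + i)" if "i < d" for i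
    proof -
      have "i < pal_len (k + 2)" using that assms(3) by (simp add: pal_len_def)
      then show ?thesis
        using match_Phi[of "k + 2" 0 "Suc 0"] Phi_1[of "k + 2"] by (simp add: match_def)
    qed
    have "match (?e - 2 * p) (?e - p) p \<longleftrightarrow> match (d - 2 * p) (d - p) p" if "2 * p \<le> d"
    proof -
      have *: "?e - 2 * p + j = ?B + (d - 2 * p + j)" "?e - p + j = ?B + (d - p + j)" for j
        using that by auto
      have eqs: "trib0 (d - 2 * p + j) = trib0 (?B + (d - 2 * p + j))"
        "trib0 (d - p + j) = trib0 (?B + (d - p + j))" if "j < p" for j
        using that \<open>2 * p \<le> d\<close> by (intro eq; simp)+
      show ?thesis unfolding match_def * using eqs by metis
    qed
    then show ?thesis by (auto simp: square_periods_def)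
  qed
  have crossing: "p \<in> square_periods ?e \<and> ?e < ?B + 2 * p \<longleftrightarrow> p = p0 \<and> tlen (k + 1) + 2 * p0 \<le> ?e" for p
  proof
    assume p: "p \<in> square_periods ?e \<and> ?e < ?B + 2 * p"
    define s where "s = ?e - 2 * p"
    have s: "0 < p" "?e = s + 2 * p" "s < ?B" "match s (s + p) p"
      using p by (auto simp: square_periods_def s_def)
    obtain k' x where x: "Phi k' x \<le> s" "Phi k' (Suc x) = Phi k' x + p" "s + p \<le> Phi k' x + pal_len k'"
      using repetition_structure[OF s(4,1)] by blast
    have e_le: "?e \<le> Phi k' (Suc x) + pal_len k'" using x s by simp
    have less: "Phi k' x < ?B" using x s by simp
    consider "k' \<ge> k + 2" | "k' = k + 1" | "k' \<le> k" by linarith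
    then show "p = p0 \<and> tlen (k + 1) + 2 * p0 \<le> ?e"
    proof cases
      case 1
      \<comment> \<open>Here the period would be at least \<open>?B > d\<close>, and the square
        would end too late.\<close>
      have mono: "?B \<le> tlen k'"
        using 1 by (simp add: strict_mono_less_eq strict_mono_tlen)
      have "Phi k' x < Phi k' (Suc 0)" using less mono Phi_1[of k'] by simp
      then have "x = 0" using strict_mono_Phi[of k'] strict_mono_less by blast
      then have "p = tlen k'" using x(2) Phi_1[of k'] by simp
      then have False using s(2) mono assms(3) pal by simp
      then show ?thesis ..
    next
      case 2
      then have "x < 2" using less B strict_mono_Phi[of k'] strict_mono_less by metis
      then consider "x = 0" | "x = 1" by linarith
      then show ?thesis
      proof cases
        case 1
        \<comment> \<open>This bound is at most \<open>?B + pal_len k\<close>, which is less than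
          \<open>?e\<close>.\<close>
        then have "?e \<le> tlen (k + 1) + pal_len (k + 1)" using e_le 2 Phi_1[of k'] by simp
        then have False using assms(2) pal(1) tlen_bounds[of k] by simp
        then show ?thesis ..
      next
        case x1: 2
        then show ?thesis using x 2 p0 s(2) by (simp add: numeral_2_eq_2)
      qed
    next
      case 3
      \<comment> \<open>\<open>?B\<close> is a boundary at level \<open>k'\<close> too, so a square
        starting before it ends by \<open>?B + pal_len k'\<close>.\<close>
      have "Phi k' (tlen (k + 2 - k')) = ?B"
        using funpow_add[of k' "k + 2 - k'" phi] 3 Phi_1[of "k + 2"] Phi_1[of "k + 2 - k'"] by simp
      then have "Suc x \<le> tlen (k + 2 - k')"
        using less strict_mono_Phi[of k'] by (metis Suc_leI strict_mono_less)
      then have "Phi k' (Suc x) \<le> ?B"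
        using \<open>Phi k' (tlen (k + 2 - k')) = ?B\<close> strict_mono_Phi[of k'] by (metis strict_mono_less_eq)
      moreover have "pal_len k' \<le> pal_len k"
        unfolding pal_len_def using 3 by (intro sum_mono2) auto
      ultimately have False using e_le assms(2) by simp
      then show ?thesis ..
    qed
  next
    assume "p = p0 \<and> tlen (k + 1) + 2 * p0 \<le> ?e"
    then have p: "p = p0" and le: "tlen (k + 1) + 2 * p0 \<le> ?e" by auto
    have "match (?e - 2 * p0) (?e - p0) p0"
      unfolding match_def
    proof (intro allI impI)
      fix j assume "j < p0"
      \<comment> \<open>\<open>i\<close> is the offset in the match between the images of the
        letters at 1 and 2, which start at \<open>tlen (k + 1)\<close> and
        \<open>?B\<close>.\<close>
      define i where "i = ?e - 2 * p0 - tlen (k + 1) + j"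
      have "i < pal_len (k + 1)"
        using \<open>j < p0\<close> le assms(3) p0 B by (simp add: i_def)
      then have "trib0 (tlen (k + 1) + i) = trib0 (?B + i)"
        using match_Phi[of "k + 1" 1 2] p0(2) B by (simp add: match_def)
      moreover have "tlen (k + 1) + i = ?e - 2 * p0 + j" "?B + i = ?e - p0 + j"
        using le p0 B by (simp_all add: i_def)
      ultimately show "trib0 (?e - 2 * p0 + j) = trib0 (?e - p0 + j)" by simp
    qed
    \<comment> \<open>This puts the start of the new square before \<open>?B\<close>, so it is not a
      translate.\<close>
    moreover have "d < 2 * p0"
    proof -
      have "tlen (k + 2) = tlen (k + 1) + p0" using B p0(1,2) by simp
      moreover have "tlen (k + 1) \<le> 2 * tlen k" "tlen (k + 1) + tlen k \<le> tlen (k + 2)"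
        using tlen_bounds[of k] by simp_all
      ultimately show ?thesis using assms(3) pal_len_tlen[of k] by linarith
    qed
    ultimately show "p \<in> square_periods ?e \<and> ?e < ?B + 2 * p"
      using p le p0 by (simp add: square_periods_def)
  qed
  have fin: "finite (square_periods n)" for n
    by (rule finite_subset[of _ "{..n}"]) (auto simp: square_periods_def)
  define C where "C = {p \<in> square_periods ?e. ?e < ?B + 2 * p}"
  have d: "square_periods d = {p \<in> square_periods ?e. ?B + 2 * p \<le> ?e}"
    by (rule set_eqI) (simp only: inner mem_Collect_eq)
  have union: "square_periods ?e = square_periods d \<union> C"
    unfolding d C_def using le_less_linear by blast
  have disj: "square_periods d \<inter> C = {}"
    unfolding d C_def using not_less by blast
  have "C = (if tlen (k + 1) + 2 * p0 \<le> ?e then {p0} else {})"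
  proof (cases "tlen (k + 1) + 2 * p0 \<le> ?e")
    case True
    then have "C = {p0}" unfolding C_def crossing by simp
    with True show ?thesis by simp
  next
    case False
    then have "C = {}" unfolding C_def crossing by simp
    with False show ?thesis by simp
  qed
  then have "card C = (if tlen (k + 1) + 2 * p0 \<le> ?e then 1 else 0)" by simp
  moreover have "card (square_periods ?e) = card (square_periods d) + card C"
    unfolding union by (rule card_Un_disjoint[OF fin _ disj]) (simp add: C_def fin)
  ultimately show ?thesis by (simp only: a_eq_card)
qed

section \<open>Summation over the intervals\<close>

lemma t_eq_tlen: "t k = int (tlen k)"
  by (simp add: t_def tlen_def)

lemma sum_atLeastAtMost_split:
  fixes f :: "int \<Rightarrow> 'b::comm_monoid_add"
  assumes "l \<le> c" "c \<le> u + 1"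
  shows "sum f {l..u} = sum f {l..c - 1} + sum f {c..u}"
proof -
  have "{l..u} = {l..c - 1} \<union> {c..u}" using assms by auto
  then show ?thesis by (simp add: sum.union_disjoint)
qed

lemma sum_shift_plus_indicator:
  fixes f :: "int \<Rightarrow> int"
  assumes "\<And>i. l \<le> i \<Longrightarrow> i \<le> u \<Longrightarrow> f i = f (i - B) + (if e \<le> i then 1 else 0)" "l \<le> e"
  shows "sum f {l..u} = sum f {l - B..u - B} + (if e \<le> u then u - e + 1 else 0)"
proof -
  have "sum f {l..u} = (\<Sum>i\<in>{l..u}. f (i - B)) + (\<Sum>i\<in>{l..u}. if e \<le> i then 1 else 0)"
    using assms(1) by (simp add: sum.distrib)
  also have "(\<Sum>i\<in>{l..u}. f (i - B)) = sum f {l - B..u - B}"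
    by (rule sum.reindex_bij_witness[of _ "\<lambda>i. i + B" "\<lambda>i. i - B"]) auto
  also have "(\<Sum>i\<in>{l..u}. if e \<le> i then 1 else 0) = (\<Sum>i\<in>{e..u}. 1 :: int)"
    using assms(2) by (intro sum.mono_neutral_cong_right) auto
  finally show ?thesis by simp
qed

lemma Min_atLeastAtMost_int: "l \<le> u \<Longrightarrow> Min {l..u :: int} = l"
  by (intro Min_eqI) auto

theorem mainTheorem9:
  fixes n :: int and m :: nat
  assumes "n \<ge> 32" and "m \<ge> 4" and "n \<in> Gamma2 m"
  shows "m \<ge> 6 \<and>
    (theta4 m \<le> n \<and> n < theta5 m \<longrightarrow>
       int (\<Sum>i = Min (Gamma2 m)..n. a i)
         = int (\<Sum>i = Min (Gamma3 (m - 2))..n - t (m - 1). a i)) \<and>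
    (theta5 m \<le> n \<and> n < eta2 m \<longrightarrow>
       int (\<Sum>i = Min (Gamma2 m)..n. a i)
         = int (\<Sum>i = Min (Gamma2 (m - 2))..n - t (m - 1). a i)
           + int (\<Sum>i\<in>Gamma3 (m - 2). a i)) \<and>
    (eta2 m \<le> n \<and> n < theta6 m \<longrightarrow>
       int (\<Sum>i = Min (Gamma2 m)..n. a i)
         = int (\<Sum>i = Min (Gamma2 (m - 2))..n - t (m - 1). a i)
           + int (\<Sum>i\<in>Gamma3 (m - 2). a i) + n - eta2 m + 1) \<and>
    (\<not> (theta4 m \<le> n \<and> n < theta5 m) \<and> \<not> (theta5 m \<le> n \<and> n < eta2 m) \<and>
     \<not> (eta2 m \<le> n \<and> n < theta6 m) \<longleftrightarrow> theta6 m \<le> n \<and> n < theta7 m) \<and>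
    (theta6 m \<le> n \<and> n < theta7 m \<longrightarrow>
       int (\<Sum>i = Min (Gamma2 m)..n. a i)
         = int (\<Sum>i = Min (Gamma1 (m - 2))..n - t (m - 1). a i)
           + int (\<Sum>i\<in>Gamma3 (m - 2). a i) + int (\<Sum>i\<in>Gamma2 (m - 2). a i)
           + n - eta2 m + 1)"
proof -
  have m6: "m \<ge> 6"
  proof (rule ccontr)
    have 23: "Suc (Suc 0) = 2" "Suc 2 = 3" by simp_all
    assume "\<not> 6 \<le> m"
    then have "m = 4 \<or> m = 5" using assms(2) by linarith
    moreover have "t 4 = 13" "t 5 = 24" using t_rec[of 1] t_rec[of 2] t_initial
      by (simp_all add: 23)
    \<comment> \<open>The upper ends of \<open>Gamma2 4\<close> and \<open>Gamma2 5\<close> are 10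
      and 20.\<close>
    ultimately show False using assms(1,3) t_initial by (auto simp: Gamma2_def 23)
  qed
  then obtain j where m: "m = j + 6" by (metis add.commute le_Suc_ex)
  define x where "x = t (j + 2)"
  define y where "y = t (j + 3)"
  define z where "z = t (j + 4)"
  have rec: "y = x + t (j + 1) + t j" "z = y + x + t (j + 1)"
    using t_rec[of j] t_rec[of "j + 1"] by (simp_all add: x_def y_def z_def eval_nat_numeral)
  have ts: "t (m - 4) = x" "t (m - 3) = y" "t (m - 2) = z" "t (m - 1) = z + y + x"
    "t m = 2 * z + 2 * y + x"
    using t_rec[of "j + 2"] t_rec[of "j + 3"] by (simp_all add: m x_def y_def z_def eval_nat_numeral)
  have bounds: "0 < t j" "t j < t (j + 1)" "t (j + 1) < x" "x \<le> 2 * t (j + 1)" "t (j + 1) \<le> 2 * t j"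
    using tlen_bounds[of j] tlen_bounds[of "j + 1"] by (simp_all add: x_def t_eq_tlen eval_nat_numeral)
  have "odd (x + z)"
    using t_parity[of "j + 4"] by (simp add: x_def z_def ac_simps)
  \<comment> \<open>This form of \<open>x + z\<close> makes the halved numerators explicitly even;
    \<open>h\<close> is \<open>pal_len (m - 3) + 1\<close>.\<close>
  then obtain h where h: "x + z = 2 * h + 1" by (elim oddE)
  then have z: "z = 2 * h + 1 - x" by simp
  define B where "B = t (m - 1)"
  define g2 where "g2 = x + 2 * y - h - 1"
  define g1 where "g1 = h + y - x"
  have B: "B = y + 2 * h + 1" using ts z by (simp add: B_def)
  have G: "Gamma3 (m - 2) = {h..g2 - 1}" "Gamma2 (m - 2) = {g2..g1 - 1}" "Gamma1 (m - 2) = {g1..h + y - 1}"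
    "Gamma2 m = {B + h..B + h + y - 1}"
    using ts m by (simp_all add: Gamma1_def Gamma2_def Gamma3_def numeral_eq_Suc z B g1_def g2_def)
  have th: "theta4 m = B + h" "theta5 m = B + g2" "theta6 m = B + g1" "theta7 m = B + h + y"
    "eta2 m = B + x + y"
    using ts by (simp_all add: theta4_def theta5_def theta6_def theta7_def eta2_def z B g1_def g2_def)
  \<comment> \<open>The sets \<open>Gamma3\<close>, \<open>Gamma2\<close>, \<open>Gamma1\<close> at
    \<open>m - 2\<close> are thus nonempty and tile \<open>{h..h + y - 1}\<close>; the jump point
    \<open>eta2 m - B = x + y\<close> lies between \<open>g2\<close> and \<open>g1\<close>.\<close>
  have order: "0 \<le> h" "h < g2" "g2 \<le> x + y" "x + y \<le> g1" "g2 < g1" "g1 \<le> h + y - 1"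
    using bounds rec z by (simp_all add: g1_def g2_def)
  \<comment> \<open>Translated by \<open>B\<close>, \<open>Gamma2 m\<close> is exactly the range of
    \<open>d\<close> in \<open>a_shift\<close> with \<open>k = m - 3\<close>, and the threshold
    there equals \<open>eta2 m\<close>.\<close>
  have shift: "int (a i) = int (a (i - B)) + (if eta2 m \<le> i then 1 else 0)"
    if "B + h \<le> i" "i \<le> B + h + y - 1" for i
  proof -
    define d where "d = nat (i - B)"
    have d: "i - B = int d" using that order by (simp add: d_def)
    have pal: "2 * int (pal_len (j + 3)) + 3 = z + x" "2 * int (pal_len (j + 4)) + 3 = x + y + z + y"
      using pal_len_tlen[of "j + 2"] pal_len_tlen[of "j + 3"] t_rec[of "j + 2"]
      by (simp_all add: x_def y_def z_def t_eq_tlen eval_nat_numeral)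
    have "pal_len (j + 3) < d" "d \<le> pal_len (j + 4)"
      using pal that d z by simp_all
    then have "a (int (tlen (j + 5) + d)) = a (int d) +
        (if tlen (j + 4) + 2 * (tlen (j + 5) - tlen (j + 4)) \<le> tlen (j + 5) + d then 1 else 0)"
      using a_shift[of "j + 3" d] by (simp add: eval_nat_numeral)
    moreover have "int (tlen (j + 5)) = B" "int (tlen (j + 4)) = z"
      by (simp_all add: B_def z_def t_eq_tlen m add.commute)
    moreover have "tlen (j + 4) < tlen (j + 5)"
      using tlen_bounds[of "j + 4"] by (simp add: eval_nat_numeral)
    moreover have "i = int (tlen (j + 5) + d)" using calculation d by simp
    moreover have "eta2 m \<le> i \<longleftrightarrow> tlen (j + 4) + 2 * (tlen (j + 5) - tlen (j + 4)) \<le> tlen (j + 5) + d"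
      using calculation(2-5) th(5) z B by linarith
    ultimately show ?thesis using d by simp
  qed
  have n: "B + h \<le> n" "n \<le> B + h + y - 1" using assms(3) G by simp_all
  have "(\<Sum>i = B + h..n. int (a i)) =
      (\<Sum>i = B + h - B..n - B. int (a i)) + (if eta2 m \<le> n then n - eta2 m + 1 else 0)"
    using n order th by (intro sum_shift_plus_indicator shift) auto
  then have main: "(\<Sum>i = B + h..n. int (a i)) =
      (\<Sum>i = h..n - B. int (a i)) + (if eta2 m \<le> n then n - eta2 m + 1 else 0)" by simp
  have split2: "(\<Sum>i = h..n - B. int (a i)) = (\<Sum>i = h..g2 - 1. int (a i)) + (\<Sum>i = g2..n - B. int (a i))"
    if "B + g2 \<le> n"
    using that order by (intro sum_atLeastAtMost_split) auto
  have split1: "(\<Sum>i = g2..n - B. int (a i)) = (\<Sum>i = g2..g1 - 1. int (a i)) + (\<Sum>i = g1..n - B. int (a i))"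
    if "B + g1 \<le> n"
    using that order by (intro sum_atLeastAtMost_split) auto
  have Mins: "Min (Gamma2 m) = B + h" "Min (Gamma3 (m - 2)) = h" "Min (Gamma2 (m - 2)) = g2"
    "Min (Gamma1 (m - 2)) = g1"
    unfolding G using n order by (simp_all add: Min_atLeastAtMost_int)
  \<comment> \<open>These decide the conditional in \<open>main\<close> in each of the four
    ranges.\<close>
  have "n < eta2 m \<Longrightarrow> n < B + g1" "B + g2 > n \<Longrightarrow> n < eta2 m" using order th by linarith+
  then have sums:
    "n < theta5 m \<Longrightarrow> (\<Sum>i = B + h..n. int (a i)) = (\<Sum>i = h..n - B. int (a i))"
    "theta5 m \<le> n \<Longrightarrow> n < eta2 m \<Longrightarrow> (\<Sum>i = B + h..n. int (a i)) =
      (\<Sum>i = g2..n - B. int (a i)) + (\<Sum>i = h..g2 - 1. int (a i))"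
    "eta2 m \<le> n \<Longrightarrow> (\<Sum>i = B + h..n. int (a i)) =
      (\<Sum>i = g2..n - B. int (a i)) + (\<Sum>i = h..g2 - 1. int (a i)) + n - eta2 m + 1"
    "theta6 m \<le> n \<Longrightarrow> (\<Sum>i = B + h..n. int (a i)) =
      (\<Sum>i = g1..n - B. int (a i)) + (\<Sum>i = h..g2 - 1. int (a i)) +
      (\<Sum>i = g2..g1 - 1. int (a i)) + n - eta2 m + 1"
    using main split1 split2 th order by simp_all
  have "\<not> (theta4 m \<le> n \<and> n < theta5 m) \<and> \<not> (theta5 m \<le> n \<and> n < eta2 m) \<and>
     \<not> (eta2 m \<le> n \<and> n < theta6 m) \<longleftrightarrow> theta6 m \<le> n \<and> n < theta7 m"
    using th order n by linarith
  then show ?thesis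
    unfolding Mins unfolding G(1,2) of_nat_sum B_def[symmetric]
    using m6 sums by blast
qed

end
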